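(* Let $N\ge 0$. Then $$V_{h,N}=\bigoplus_{n=0}^N \mathcal{R}_{N-1}\mathcal{R}_{N-2}\cdots \mathcal{R}_n\bigl[\mathrm{Ker}\,\mathcal{L}_n\bigr]$$ is the orthogonal decomposition (with respect to $\langle\cdot,\cdot\rangle_{V_{h,N}}$) of $V_{h,N}$ into eigenspaces of $\mathcal{D}_N$. The eigenvalue associated to the eigenspace $\mathcal{R}_{N-1}\mathcal{R}_{N-2}\cdots \mathcal{R}_n\bigl[\mathrm{Ker}\,\mathcal{L}_n\bigr]$ is equal to $$q^{-n}(1-q^n)(1-A_h q^{n+h-1}).$$
   Context: Let $0<q<1$, let $h\ge 1$ and $N\ge 0$ be integers, and let $\alpha_1,\dots,\alpha_h$ be real numbers such that either $0<\alpha_i<q^{-1}$ for all $i$, or $\alpha_i>q^{-N}$ for all $i$. Write $(a;q)_k=\prod_{j=0}^{k-1}(1-aq^j)$. For an integer $M\ge 0$, $[h;M]$ is the set of $\mathbf{x}=(x_1,\dots,x_h)$ with $x_i$ nonnegative integers and $x_1+\cdots+x_h=M$; $V_{h,M}$ is the space of complex functions on $[h;M]$. Put $X_k=x_1+\cdots+x_k$, $A_k=\alpha_1\cdots\alpha_k$, $X_0=0$, $A_0=1$. $\epsilon_j^{\pm}(\mathbf{x})$ is $\mathbf{x}$ with $x_j$ replaced by $x_j\pm1$; $[i<j]=1$ if $i<j$ and $0$ otherwise; values of functions at points outside their domain are taken to be $0$. The scalar product on $V_{h,M}$ ($0\le M\le N$) is $$\langle f_1,f_2 \rangle_{V_{h,M}}=q^{M(M+1)/2}\sum_{\mathbf{x}\in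 [h;M]}\prod_{i=1}^h\left[\frac{(q\alpha_i;q)_{x_i}}{(q;q)_{x_i}}(\alpha_i q)^{M-X_i}\right]f_1(\mathbf{x})\overline{f_2(\mathbf{x})}.$$ (In the case $\alpha_i>q^{-N}$ this form is definite, with sign $(-1)^M$.) Operators: $\mathcal{R}_M:V_{h,M}\to V_{h,M+1}$, $\mathcal{L}_M:V_{h,M}\to V_{h,M-1}$, $\mathcal{D}_M:V_{h,M}\to V_{h,M}$ given by $$\mathcal{R}_Mf(\mathbf{x})=\sum_{i=1}^hq^{X_{i-1}-M-1}(1-q^{x_i})f(\epsilon_i^-(\mathbf{x})),\qquad \mathcal{L}_Mf(\mathbf{x})=\sum_{j=1}^hA_{j-1}q^{j-1+X_{j-1}}(\alpha_jq^{x_j+1}-1)f(\epsilon_j^+(\mathbf{x})),$$ $$\mathcal{D}_Mf(\mathbf{x})=\sum_{\substack{i,j=1\\ i\ne j}}^hA_{j-1}q^{j-1+X_{j-1}+X_{i-1}-M-[i<j]}(\alpha_jq^{x_j+1}-1)(1-q^{x_i})f(\epsilon_i^-\epsilon_j^+(\mathbf{x}))$$ $$\qquad+\Bigl\{\sum_{j=1}^hA_{j-1}q^{j-1+2X_{j-1}-M}(\alpha_jq^{x_j}-1)(1-q^{x_j})+(A_hq^{h+M-1}-1)(1-q^{-M})\Bigr\}f(\mathbf{x}).$$ Convention: $V_{h,-1}=\{0\}$, so $\mathcal{L}_0=0$ and $\mathrm{Ker}\,\mathcal{L}_0=V_{h,0}$. For $n=N$ the product $\mathcal{R}_{N-1}\cdots\mathcal{R}_n$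 is the identity. *)

theory Defs
  imports Complex_Main "HOL-Library.FuncSet" "HOL-Library.Function_Algebras"
begin

definition qpoch :: "real \<Rightarrow> real \<Rightarrow> nat \<Rightarrow> real" where
  "qpoch a q k = (\<Prod>j<k. 1 - a * q ^ j)"

text \<open>
  A point \<open>(x\<^sub>1,\<dots>,x\<^sub>h)\<close> is a function on all of \<open>nat\<close> that vanishes off \<open>{1..h}\<close>, and
  \<open>V\<^sub>h\<^sub>,\<^sub>M\<close> consists of the functions on points that vanish off \<open>[h;M]\<close>. Hence the value of an
  element of \<open>V\<^sub>h\<^sub>,\<^sub>M\<close> at a point outside \<open>[h;M]\<close> is \<open>0\<close>.
\<close>

type_synonym point = "nat \<Rightarrow> nat"

definition compositions :: "nat \<Rightarrow> nat \<Rightarrow> point set" where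
  "compositions h M = {x. (\<forall>i. i \<notin> {1..h} \<longrightarrow> x i = 0) \<and> (\<Sum>i=1..h. x i) = M}"

definition V :: "nat \<Rightarrow> nat \<Rightarrow> (point \<Rightarrow> complex) set" where
  "V h M = {f. \<forall>x. x \<notin> compositions h M \<longrightarrow> f x = 0}"

definition X :: "point \<Rightarrow> nat \<Rightarrow> nat" where
  "X x k = (\<Sum>i=1..k. x i)"

definition A :: "(nat \<Rightarrow> real) \<Rightarrow> nat \<Rightarrow> real" where
  "A \<alpha> k = (\<Prod>i=1..k. \<alpha> i)"

definition eps_plus :: "nat \<Rightarrow> point \<Rightarrow> point" where
  "eps_plus j x = x(j := x j + 1)"

text \<open>
  If \<open>x i = 0\<close>, truncated subtraction gives \<open>eps_minus i x = x\<close>. In the operators below this is then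
  a point of the wrong total, outside the domain of the function it is inserted into (and it comes
  with the factor \<open>1 - q ^ 0 = 0\<close>).
\<close>

definition eps_minus :: "nat \<Rightarrow> point \<Rightarrow> point" where
  "eps_minus i x = x(i := x i - 1)"

text \<open>The subtraction \<open>M - X x i\<close> does not truncate, since \<open>X x i \<le> M\<close> on \<open>[h;M]\<close>.\<close>

definition scalar_product ::
  "real \<Rightarrow> nat \<Rightarrow> (nat \<Rightarrow> real) \<Rightarrow> nat \<Rightarrow> (point \<Rightarrow> complex) \<Rightarrow> (point \<Rightarrow> complex) \<Rightarrow> complex" where
  "scalar_product q h \<alpha> M f1 f2 =
     complex_of_real (q ^ (M * (M + 1) div 2)) *
     (\<Sum>x\<in>compositions h M.
        complex_of_real (\<Prod>i=1..h. qpoch (q * \<alpha> i) q (x i) / qpoch q q (x i)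
                                   * (\<alpha> i * q) ^ (M - X x i))
        * f1 x * cnj (f2 x))"

definition R :: "real \<Rightarrow> nat \<Rightarrow> nat \<Rightarrow> (point \<Rightarrow> complex) \<Rightarrow> (point \<Rightarrow> complex)" where
  "R q h M f = (\<lambda>x. if x \<in> compositions h (M + 1) then
     (\<Sum>i=1..h. complex_of_real (q powi (int (X x (i - 1)) - int M - 1) * (1 - q ^ x i))
                * f (eps_minus i x))
     else 0)"

definition L :: "real \<Rightarrow> nat \<Rightarrow> (nat \<Rightarrow> real) \<Rightarrow> nat \<Rightarrow> (point \<Rightarrow> complex) \<Rightarrow> (point \<Rightarrow> complex)" where
  "L q h \<alpha> M f = (\<lambda>x. if M \<ge> 1 \<and> x \<in> compositions h (M - 1) then
     (\<Sum>j=1..h. complex_of_real (A \<alpha> (j - 1) * q ^ (j - 1 + X x (j - 1)) * (\<alpha> j * q ^ (x j + 1) - 1))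
                * f (eps_plus j x))
     else 0)"

definition D :: "real \<Rightarrow> nat \<Rightarrow> (nat \<Rightarrow> real) \<Rightarrow> nat \<Rightarrow> (point \<Rightarrow> complex) \<Rightarrow> (point \<Rightarrow> complex)" where
  "D q h \<alpha> M f = (\<lambda>x. if x \<in> compositions h M then
     (\<Sum>i=1..h. \<Sum>j\<in>{1..h} - {i}.
        complex_of_real
          (A \<alpha> (j - 1)
           * q powi (int j - 1 + int (X x (j - 1)) + int (X x (i - 1)) - int M - of_bool (i < j))
           * (\<alpha> j * q ^ (x j + 1) - 1) * (1 - q ^ x i))
        * f (eps_minus i (eps_plus j x)))
     + complex_of_real
         ((\<Sum>j=1..h. A \<alpha> (j - 1) * q powi (int j - 1 + 2 * int (X x (j - 1)) - int M)
                    * (\<alpha> j * q ^ x j - 1) * (1 - q ^ x j))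
          + (A \<alpha> h * q powi (int h + int M - 1) - 1) * (1 - q powi (- int M)))
       * f x
     else 0)"

definition Ker_L :: "real \<Rightarrow> nat \<Rightarrow> (nat \<Rightarrow> real) \<Rightarrow> nat \<Rightarrow> (point \<Rightarrow> complex) set" where
  "Ker_L q h \<alpha> n = {f \<in> V h n. L q h \<alpha> n f = 0}"

text \<open>
  \<open>fold (R q h) [n..<N]\<close> applies \<open>R q h n\<close> first and \<open>R q h (N - 1)\<close> last; it is the identity
  for \<open>n = N\<close>.
\<close>

definition W :: "real \<Rightarrow> nat \<Rightarrow> (nat \<Rightarrow> real) \<Rightarrow> nat \<Rightarrow> nat \<Rightarrow> (point \<Rightarrow> complex) set" where
  "W q h \<alpha> N n = fold (R q h) [n..<N] ` Ker_L q h \<alpha> n"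

definition cscale :: "complex \<Rightarrow> ('a \<Rightarrow> complex) \<Rightarrow> ('a \<Rightarrow> complex)" where
  "cscale c f = (\<lambda>x. c * f x)"

interpretation cfun: vector_space "cscale :: complex \<Rightarrow> ('a \<Rightarrow> complex) \<Rightarrow> ('a \<Rightarrow> complex)"
  by unfold_locales (auto simp: cscale_def fun_eq_iff algebra_simps)

text \<open>
  Internal direct sum: addition is a bijection from the product of the subspaces \<open>S n\<close> onto \<open>U\<close>.
\<close>

definition is_direct_sum ::
  "('a \<Rightarrow> complex) set \<Rightarrow> nat set \<Rightarrow> (nat \<Rightarrow> ('a \<Rightarrow> complex) set) \<Rightarrow> bool" where
  "is_direct_sum U I S \<longleftrightarrow>
     (\<forall>n\<in>I. cfun.subspace (S n)) \<and> bij_betw (\<lambda>w. \<Sum>n\<in>I. w n) (Pi\<^sub>E I S) U"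

definition eigenspace ::
  "('a \<Rightarrow> complex) set \<Rightarrow> (('a \<Rightarrow> complex) \<Rightarrow> ('a \<Rightarrow> complex)) \<Rightarrow> complex \<Rightarrow> ('a \<Rightarrow> complex) set" where
  "eigenspace U T c = {f \<in> U. T f = cscale c f}"

end

(* D_M is R L plus the scalar ev M, and moving R past L changes only this scalar, because the
   diagonal terms telescope: L R = D_M - ev (M + 1). Hence D_{M+1} R = R D_M, and R_{N-1} ... R_n
   carries Ker L_n into the eigenspace of ev n. Spanning follows by induction on N: if L f = sum of
   w_n with w_n in W N n, then L R acts on w_n as ev n - ev (N + 1), so dividing by these
   scalars gives g with L R g = L f, and f - R g lies in Ker L. The form enters only in the
   orthogonality, through the self-adjointness of D, which follows from R* = -L. *)

theory Submission
  imports Defs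
begin

text \<open>The obstacle is that eigenvalues may collide, while both the division by
  \<open>ev n - ev (N + 1)\<close> and independence call for distinct ones. For
  \<open>m \<noteq> n\<close>, equality of \<open>ev m\<close> and \<open>ev n\<close> forces
  \<open>A_h q^(h-1+m+n) = 1\<close>. This cannot happen if all \<open>\<alpha>_i < 1/q\<close>. If
  all \<open>\<alpha>_i > q^(-N)\<close>, it leaves only \<open>h = 1\<close>, where
  \<open>L_n\<close> is injective for \<open>1 \<le> n \<le> N\<close>. So colliding indices
  contribute zero spaces, and \<open>separated\<close> is the form in which the hypothesis on
  \<open>\<alpha>\<close> reaches the argument: each step that would divide by a difference of
  eigenvalues first splits off the case of equality.

  The number \<open>ev M\<close> has two roles: it is the claimed eigenvalue, and it is the part of
  the diagonal coefficient of \<open>D_M\<close> that does not depend on the point.\<close>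

definition ev :: "real \<Rightarrow> nat \<Rightarrow> (nat \<Rightarrow> real) \<Rightarrow> nat \<Rightarrow> real" where
  "ev q h \<alpha> n = q powi (- int n) * (1 - q ^ n) * (1 - A \<alpha> h * q powi (int n + int h - 1))"

section \<open>Partial sums and unit shifts of compositions\<close>

lemma A_0 [simp]: "A \<alpha> 0 = 1"
  by (simp add: A_def)

lemma A_Suc [simp]: "A \<alpha> (Suc k) = A \<alpha> k * \<alpha> (Suc k)"
  by (simp add: A_def prod.nat_ivl_Suc')

lemma X_0 [simp]: "X x 0 = 0"
  by (simp add: X_def)

lemma X_Suc [simp]: "X x (Suc k) = X x k + x (Suc k)"
  by (simp add: X_def)

lemma X_eps_plus:
  "j \<ge> 1 \<Longrightarrow> X (eps_plus j x) k = (if j \<le> k then X x k + 1 else X x k)"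
  by (induction k) (auto simp: eps_plus_def le_Suc_eq)

text \<open>Positivity of \<open>X x k\<close> is carried through the induction so that the
  natural-number difference \<open>X x k - 1\<close> is a genuine one.\<close>

lemma X_eps_minus:
  "i \<ge> 1 \<Longrightarrow> x i > 0 \<Longrightarrow> X (eps_minus i x) k = (if i \<le> k then X x k - 1 else X x k)
     \<and> (i \<le> k \<longrightarrow> X x k > 0)"
  by (induction k) (auto simp: eps_minus_def le_Suc_eq)

lemma compositions_X: "x \<in> compositions h M \<longleftrightarrow> (\<forall>i. i \<notin> {1..h} \<longrightarrow> x i = 0) \<and> X x h = M"
  by (simp add: compositions_def X_def)

lemma eps_plus_compositions:
  "x \<in> compositions h M \<Longrightarrow> j \<in> {1..h} \<Longrightarrow> eps_plus j x \<in> compositions h (Suc M)"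
  by (auto simp: compositions_X X_eps_plus) (auto simp: eps_plus_def)

lemma eps_minus_compositions:
  "x \<in> compositions h (Suc M) \<Longrightarrow> i \<in> {1..h} \<Longrightarrow> x i > 0 \<Longrightarrow> eps_minus i x \<in> compositions h M"
  using X_eps_minus[of i x h] by (auto simp: compositions_X) (auto simp: eps_minus_def)

lemma eps_minus_plus [simp]: "eps_minus i (eps_plus i x) = x"
  by (auto simp: eps_minus_def eps_plus_def)

lemma eps_plus_minus: "x i > 0 \<Longrightarrow> eps_plus i (eps_minus i x) = x"
  by (auto simp: eps_minus_def eps_plus_def)

lemma eps_commute: "i \<noteq> j \<Longrightarrow> eps_plus j (eps_minus i x) = eps_minus i (eps_plus j x)"
  by (auto simp: eps_minus_def eps_plus_def)

lemma X_mono: "k \<le> l \<Longrightarrow> X x k \<le> X x l"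
  unfolding X_def by (intro sum_mono2) auto

lemma finite_compositions: "finite (compositions h M)"
proof (rule finite_subset)
  show "compositions h M \<subseteq> {x. \<forall>i. (i \<in> {1..h} \<longrightarrow> x i \<in> {..M}) \<and> (i \<notin> {1..h} \<longrightarrow> x i = 0)}"
    by (auto simp: compositions_def intro!: member_le_sum)
  show "finite {x. \<forall>i. (i \<in> {1..h} \<longrightarrow> x i \<in> {..M}) \<and> (i \<notin> {1..h} \<longrightarrow> x i = (0::nat))}"
    by (rule finite_set_of_finite_funs) auto
qed

section \<open>Linearity\<close>

lemma V_subspace: "cfun.subspace (V h M)"
  by (auto simp: cfun.subspace_def V_def cscale_def)

lemma R_V: "R q h M f \<in> V h (Suc M)"
  by (auto simp: R_def V_def)

lemma L_V: "L q h \<alpha> (Suc M) f \<in> V h M"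
  by (auto simp: L_def V_def)

lemma R_add: "R q h M (f + g) = R q h M f + R q h M g"
  by (simp add: R_def fun_eq_iff distrib_left sum.distrib)

lemma R_scale: "R q h M (cscale c f) = cscale c (R q h M f)"
  by (auto simp: R_def cscale_def fun_eq_iff sum_distrib_left intro!: sum.cong)

lemma L_add: "L q h \<alpha> M (f + g) = L q h \<alpha> M f + L q h \<alpha> M g"
  by (simp add: L_def fun_eq_iff distrib_left sum.distrib)

lemma L_scale: "L q h \<alpha> M (cscale c f) = cscale c (L q h \<alpha> M f)"
  by (auto simp: L_def cscale_def fun_eq_iff sum_distrib_left intro!: sum.cong)

lemma D_add: "D q h \<alpha> M (f + g) = D q h \<alpha> M f + D q h \<alpha> M g"
  by (auto simp: D_def fun_eq_iff distrib_left sum.distrib)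

lemma D_scale: "D q h \<alpha> M (cscale c f) = cscale c (D q h \<alpha> M f)"
  by (auto simp: D_def cscale_def fun_eq_iff sum_distrib_left distrib_left intro!: sum.cong)

lemma linear_sum:
  fixes T :: "('a \<Rightarrow> complex) \<Rightarrow> ('b \<Rightarrow> complex)"
  assumes "\<And>f g. T (f + g) = T f + T g" and "\<And>c f. T (cscale c f) = cscale c (T f)"
  shows "T (\<Sum>n\<in>I. w n) = (\<Sum>n\<in>I. T (w n))"
proof (induction I rule: infinite_finite_induct)
  case (insert a I)
  then have "T (\<Sum>n\<in>insert a I. w n) = (\<Sum>n\<in>insert a I. T (w n))"
    by (simp add: assms(1))
  then show ?case .
\<comment> \<open>Empty and infinite index sets need \<open>T 0 = 0\<close>, which is homogeneity at
  the scalar 0. The same instance gives it for \<open>R\<close> and \<open>L\<close> later.\<close>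
qed (use assms(2)[of 0 0] in \<open>auto simp: cscale_def zero_fun_def\<close>)

section \<open>The factorization of \<open>D\<close> and the commutation relation\<close>

lemma ev_alt:
  assumes "q > 0" "h \<ge> 1"
  shows "ev q h \<alpha> n = (1 / q ^ n - 1) * (1 - A \<alpha> h * q ^ (n + h - 1))"
proof -
  have "int n + int h - 1 = int (n + h - 1)" using assms by simp
  then have "q powi (int n + int h - 1) = q ^ (n + h - 1)"
    by (metis power_int_of_nat)
  then show ?thesis
    using assms by (simp add: ev_def power_int_minus field_simps)
qed

text \<open>At total 0 all coordinates are 0, so every term has a factor \<open>1 - q^0\<close>.
  This stands in for the factorization through \<open>L\<close>, which has no level below 0 to pass
  through.\<close>

lemma D_0: "D q h \<alpha> 0 f = 0"
proof
  fix x
  show "D q h \<alpha> 0 f x = 0 x"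
    unfolding D_def by (auto simp: compositions_def intro!: sum.neutral)
qed

text \<open>With coefficients separated from point evaluations, composing two operators amounts to
  multiplying coefficients, the second one taken at the shifted point.\<close>

definition offdiag :: "real \<Rightarrow> (nat \<Rightarrow> real) \<Rightarrow> nat \<Rightarrow> point \<Rightarrow> nat \<Rightarrow> nat \<Rightarrow> real" where
  "offdiag q \<alpha> M x i j = A \<alpha> (j - 1)
      * q powi (int j - 1 + int (X x (j - 1)) + int (X x (i - 1)) - int M - of_bool (i < j))
      * (\<alpha> j * q ^ (x j + 1) - 1) * (1 - q ^ x i)"

definition diag :: "real \<Rightarrow> (nat \<Rightarrow> real) \<Rightarrow> nat \<Rightarrow> point \<Rightarrow> nat \<Rightarrow> real" where
  "diag q \<alpha> M x j = A \<alpha> (j - 1) * q powi (int j - 1 + 2 * int (X x (j - 1)) - int M)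
      * (\<alpha> j * q ^ x j - 1) * (1 - q ^ x j)"

definition Rcoeff :: "real \<Rightarrow> nat \<Rightarrow> point \<Rightarrow> nat \<Rightarrow> real" where
  "Rcoeff q M x i = q powi (int (X x (i - 1)) - int M - 1) * (1 - q ^ x i)"

definition Lcoeff :: "real \<Rightarrow> (nat \<Rightarrow> real) \<Rightarrow> point \<Rightarrow> nat \<Rightarrow> real" where
  "Lcoeff q \<alpha> x j = A \<alpha> (j - 1) * q ^ (j - 1 + X x (j - 1)) * (\<alpha> j * q ^ (x j + 1) - 1)"

lemma R_eq: "x \<in> compositions h (Suc M) \<Longrightarrow>
  R q h M f x = (\<Sum>i=1..h. complex_of_real (Rcoeff q M x i) * f (eps_minus i x))"
  by (simp add: R_def Rcoeff_def)

lemma L_eq: "x \<in> compositions h M \<Longrightarrow>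
  L q h \<alpha> (Suc M) f x = (\<Sum>j=1..h. complex_of_real (Lcoeff q \<alpha> x j) * f (eps_plus j x))"
  by (simp add: L_def Lcoeff_def)

lemma D_eq:
  assumes "x \<in> compositions h M" "q > 0"
  shows "D q h \<alpha> M f x =
     (\<Sum>i=1..h. \<Sum>j\<in>{1..h} - {i}. complex_of_real (offdiag q \<alpha> M x i j) * f (eps_minus i (eps_plus j x)))
     + (\<Sum>i=1..h. complex_of_real (diag q \<alpha> M x i) * f x) + complex_of_real (ev q h \<alpha> M) * f x"
proof -
  have "(A \<alpha> h * q powi (int h + int M - 1) - 1) * (1 - q powi (- int M)) = ev q h \<alpha> M"
    using assms by (simp add: ev_def power_int_minus field_simps)
  then show ?thesis
    using assms(1) unfolding D_def offdiag_def[symmetric] diag_def[symmetric]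
    by (simp add: sum_distrib_right[symmetric] distrib_right)
qed

text \<open>Lowering \<open>x_i\<close> lowers \<open>X_(j-1)\<close> exactly when
  \<open>i < j\<close>, which is the origin of \<open>[i<j]\<close> in the exponent. If
  \<open>x_i = 0\<close>, the factor \<open>1 - q^(x_i)\<close> kills both sides.\<close>

lemma Rcoeff_Lcoeff_offdiag:
  assumes "q > 0" "i \<ge> 1" "j \<ge> 1" "i \<noteq> j"
  shows "Rcoeff q M x i * Lcoeff q \<alpha> (eps_minus i x) j = offdiag q \<alpha> (Suc M) x i j"
proof (cases "x i = 0")
  case False
  have j: "int (j - 1) = int j - 1" using assms by simp
  have p: "q powi (int (X x (i - 1)) - int M - 1) * q ^ (j - 1 + X (eps_minus i x) (j - 1))
      = q powi (int j - 1 + int (X x (j - 1)) + int (X x (i - 1)) - int (Suc M) - of_bool (i < j))"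
    using False assms X_eps_minus[of i x "j - 1"]
    by (subst power_int_of_nat[symmetric], subst power_int_add[symmetric])
      (auto intro!: arg_cong2[where f = "(powi)"])
  have "eps_minus i x j = x j" using assms by (simp add: eps_minus_def)
  then show ?thesis
    unfolding Rcoeff_def Lcoeff_def offdiag_def p[symmetric] by (simp add: ac_simps)
qed (simp add: Rcoeff_def offdiag_def)

lemma Rcoeff_Lcoeff_diag:
  assumes "q > 0" "i \<ge> 1"
  shows "Rcoeff q M x i * Lcoeff q \<alpha> (eps_minus i x) i = diag q \<alpha> (Suc M) x i"
proof (cases "x i = 0")
  case False
  have p: "q powi (int (X x (i - 1)) - int M - 1) * q ^ (i - 1 + X (eps_minus i x) (i - 1))
      = q powi (int i - 1 + 2 * int (X x (i - 1)) - int (Suc M))"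
    using False assms X_eps_minus[of i x "i - 1"]
    by (subst power_int_of_nat[symmetric], subst power_int_add[symmetric])
      (auto intro!: arg_cong2[where f = "(powi)"])
  have "eps_minus i x i + 1 = x i" using False by (simp add: eps_minus_def)
  then show ?thesis
    unfolding Rcoeff_def Lcoeff_def diag_def p[symmetric] by (simp add: ac_simps)
qed (simp add: Rcoeff_def diag_def)

text \<open>Raising \<open>x_j\<close> raises \<open>X_(i-1)\<close> by
  \<open>[j<i] = 1 - [i<j]\<close>. The extra 1 cancels the \<open>-1\<close> in the exponent of
  \<open>Rcoeff\<close>, so the result is the coefficient at level \<open>M\<close> instead of
  \<open>Suc M\<close>.\<close>

lemma Lcoeff_Rcoeff_offdiag:
  assumes "q > 0" "i \<ge> 1" "j \<ge> 1" "i \<noteq> j"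
  shows "Lcoeff q \<alpha> x j * Rcoeff q M (eps_plus j x) i = offdiag q \<alpha> M x i j"
proof -
  have p: "q powi (int (X (eps_plus j x) (i - 1)) - int M - 1) * q ^ (j - 1 + X x (j - 1))
      = q powi (int j - 1 + int (X x (j - 1)) + int (X x (i - 1)) - int M - of_bool (i < j))"
    using assms X_eps_plus[of j x "i - 1"]
    by (subst power_int_of_nat[symmetric], subst power_int_add[symmetric])
      (auto intro!: arg_cong2[where f = "(powi)"])
  have "eps_plus j x i = x i" using assms by (simp add: eps_plus_def)
  then show ?thesis
    unfolding Rcoeff_def Lcoeff_def offdiag_def p[symmetric] by (simp add: ac_simps)
qed

text \<open>Here both factors see \<open>x_j + 1\<close> where \<open>diag\<close> has
  \<open>x_j\<close>. With \<open>t = q^(x_j)\<close>, the two products have the same terms linear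
  in \<open>t\<close> after the division by \<open>q\<close>; the constant and quadratic terms
  differ, and their difference is an increment of \<open>A_j q^(j + 2 X_j)\<close>.\<close>

lemma Lcoeff_Rcoeff_diag:
  assumes "q > 0" "j \<ge> 1"
  shows "Lcoeff q \<alpha> x j * Rcoeff q M (eps_plus j x) j = diag q \<alpha> M x j
    + (1 - 1 / q) / q ^ M * (A \<alpha> (j - 1) * q ^ (j - 1 + 2 * X x (j - 1)) - A \<alpha> j * q ^ (j + 2 * X x j))"
proof -
  obtain k where k: "j = Suc k" using assms by (cases j) auto
  have p: "q powi (int k + 2 * int (X x k) - int M) = q ^ k * (q ^ X x k)\<^sup>2 / q ^ M"
  proof -
    have e: "int k + 2 * int (X x k) = int (k + X x k * 2)" by simp
    show ?thesis
      unfolding e using assms(1)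
      by (simp add: power_int_diff power_add power_mult del: of_nat_add of_nat_mult)
  qed
  have r: "q powi (int (X x k) - int M - 1) = q ^ X x k / q ^ M / q"
    using assms by (simp add: power_int_diff)
  have s: "q ^ (k + 2 * X x k) = q ^ k * (q ^ X x k)\<^sup>2"
    "q ^ (Suc k + 2 * X x (Suc k)) = q * q ^ k * (q ^ X x k * q ^ x (Suc k))\<^sup>2"
    by (simp_all add: power_add power_even_eq power_mult_distrib)
  have t: "eps_plus (Suc k) x (Suc k) = Suc (x (Suc k))" "X (eps_plus (Suc k) x) k = X x k"
    by (simp_all add: X_eps_plus) (simp add: eps_plus_def)
  define a Q Y t P where "a = A \<alpha> k" and "Q = q ^ k" and "Y = q ^ X x k" and "t = q ^ x (Suc k)"
    and "P = q ^ M"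
  have "a * (Q * Y) * (\<alpha> (Suc k) * (q * t) - 1) * (Y / P / q * (1 - q * t))
    = a * (Q * Y\<^sup>2 / P) * (\<alpha> (Suc k) * t - 1) * (1 - t)
      + (1 - 1 / q) / P * (a * (Q * Y\<^sup>2) - a * \<alpha> (Suc k) * (q * Q * (Y * t)\<^sup>2))"
  proof -
    have "P \<noteq> 0" using assms by (simp add: P_def)
    then show ?thesis using assms(1) by (simp add: field_simps power2_eq_square)
  qed
  then show ?thesis
    unfolding k Lcoeff_def Rcoeff_def diag_def diff_Suc_1 t r p s A_Suc
      a_def Q_def Y_def t_def P_def
    by (simp add: p power_add)
qed

text \<open>The end values of the telescoping sum are 1 and \<open>A_h q^(h + 2M)\<close>, since
  \<open>X_h = M\<close> on \<open>[h;M]\<close>. They do not depend on \<open>x\<close>, so the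
  correction is a scalar and not merely a diagonal operator.\<close>

lemma sum_diag:
  assumes "q > 0" "h \<ge> 1" "x \<in> compositions h M"
  shows "(\<Sum>j=1..h. Lcoeff q \<alpha> x j * Rcoeff q M (eps_plus j x) j)
    = (\<Sum>j=1..h. diag q \<alpha> M x j) + ev q h \<alpha> M - ev q h \<alpha> (Suc M)"
proof -
  define B where "B = (\<lambda>j. A \<alpha> j * q ^ (j + 2 * X x j))"
  have tel: "(\<Sum>j=1..h. B (j - 1) - B j) = B 0 - B h"
    by (induction h) auto
  obtain k where k: "h = Suc k" using assms by (cases h) auto
  have B: "B 0 - B h = 1 - A \<alpha> h * q ^ (h + 2 * M)"
    using assms by (simp add: B_def compositions_X)
  have "(1 - 1 / q) / q ^ M * (1 - A \<alpha> h * q ^ (h + 2 * M)) = ev q h \<alpha> M - ev q h \<alpha> (Suc M)"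
    using assms(1) unfolding ev_alt[OF assms(1,2), unfolded k] k
    by (simp add: field_simps power_add power_mult power2_eq_square mult_2_right mult_2)
  then have "(1 - 1 / q) / q ^ M * (B 0 - B h) = ev q h \<alpha> M - ev q h \<alpha> (Suc M)"
    by (simp only: B)
  moreover have "(\<Sum>j=1..h. Lcoeff q \<alpha> x j * Rcoeff q M (eps_plus j x) j)
      = (\<Sum>j=1..h. diag q \<alpha> M x j + (1 - 1 / q) / q ^ M * (B (j - 1) - B j))"
    using assms(1) unfolding B_def by (intro sum.cong refl Lcoeff_Rcoeff_diag) auto
  ultimately show ?thesis
    using tel by (simp only: sum.distrib sum_distrib_left[symmetric] add_diff_eq)
qed

lemma sum_split_diag:
  fixes F :: "nat \<Rightarrow> nat \<Rightarrow> 'a::comm_monoid_add"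
  shows "(\<Sum>i=1..h. \<Sum>j=1..h. F i j) = (\<Sum>i=1..h. \<Sum>j\<in>{1..h}-{i}. F i j) + (\<Sum>i=1..h. F i i)"
  unfolding sum.distrib[symmetric]
  by (intro sum.cong refl) (subst sum.remove, auto simp: add.commute)

lemma D_eq_R_L:
  assumes "q > 0" "f \<in> V h (Suc M)"
  shows "D q h \<alpha> (Suc M) f = R q h M (L q h \<alpha> (Suc M) f) + cscale (complex_of_real (ev q h \<alpha> (Suc M))) f"
proof
  fix x
  show "D q h \<alpha> (Suc M) f x
      = (R q h M (L q h \<alpha> (Suc M) f) + cscale (complex_of_real (ev q h \<alpha> (Suc M))) f) x"
  proof (cases "x \<in> compositions h (Suc M)")
    case False
    then show ?thesis using assms by (simp add: D_def R_def cscale_def V_def)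
  next
    case True
    have "complex_of_real (Rcoeff q M x i) * L q h \<alpha> (Suc M) f (eps_minus i x)
      = (\<Sum>j=1..h. complex_of_real (Rcoeff q M x i * Lcoeff q \<alpha> (eps_minus i x) j)
            * f (eps_plus j (eps_minus i x)))" if "i \<in> {1..h}" for i
    \<comment> \<open>If \<open>x i = 0\<close>, then \<open>eps_minus i x\<close> is
      \<open>x\<close>, which has the wrong total for \<open>L_eq\<close>; the claim holds because
      \<open>Rcoeff\<close> vanishes.\<close>
    proof (cases "x i = 0")
      case False
      then show ?thesis
        using eps_minus_compositions[OF True that]
        by (simp add: L_eq sum_distrib_left mult.assoc)
    qed (simp add: Rcoeff_def)
    then have "R q h M (L q h \<alpha> (Suc M) f) x
      = (\<Sum>i=1..h. \<Sum>j=1..h. complex_of_real (Rcoeff q M x i * Lcoeff q \<alpha> (eps_minus i x) j)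
            * f (eps_plus j (eps_minus i x)))"
      using True by (simp add: R_eq)
    also have "\<dots> = (\<Sum>i=1..h. \<Sum>j\<in>{1..h} - {i}. complex_of_real (offdiag q \<alpha> (Suc M) x i j)
            * f (eps_minus i (eps_plus j x)))
        + (\<Sum>i=1..h. complex_of_real (diag q \<alpha> (Suc M) x i) * f x)"
    proof (subst sum_split_diag, intro arg_cong2[where f = "(+)"] sum.cong refl)
      fix i assume i: "i \<in> {1..h}"
      show "complex_of_real (Rcoeff q M x i * Lcoeff q \<alpha> (eps_minus i x) i) * f (eps_plus i (eps_minus i x))
        = complex_of_real (diag q \<alpha> (Suc M) x i) * f x"
        using i assms(1) by (cases "x i = 0") (auto simp: Rcoeff_Lcoeff_diag eps_plus_minus diag_def)
    qed (use assms(1) in \<open>auto simp: Rcoeff_Lcoeff_offdiag eps_commute\<close>)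
    finally show ?thesis
      using D_eq[OF True assms(1)] by (simp add: cscale_def)
  qed
qed

lemma L_R_eq_D:
  assumes "q > 0" "h \<ge> 1" "f \<in> V h M"
  shows "L q h \<alpha> (Suc M) (R q h M f) = D q h \<alpha> M f - cscale (complex_of_real (ev q h \<alpha> (Suc M))) f"
proof
  fix x
  show "L q h \<alpha> (Suc M) (R q h M f) x
      = (D q h \<alpha> M f - cscale (complex_of_real (ev q h \<alpha> (Suc M))) f) x"
  proof (cases "x \<in> compositions h M")
    case False
    then show ?thesis using assms by (simp add: D_def L_def cscale_def V_def)
  next
    case True
    have "L q h \<alpha> (Suc M) (R q h M f) x
      = (\<Sum>j=1..h. \<Sum>i=1..h. complex_of_real (Lcoeff q \<alpha> x j * Rcoeff q M (eps_plus j x) i)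
            * f (eps_minus i (eps_plus j x)))"
      using True by (simp add: L_eq R_eq eps_plus_compositions sum_distrib_left mult.assoc)
    also have "\<dots> = (\<Sum>i=1..h. \<Sum>j=1..h. complex_of_real (Lcoeff q \<alpha> x j * Rcoeff q M (eps_plus j x) i)
            * f (eps_minus i (eps_plus j x)))"
      by (rule sum.swap)
    also have "\<dots> = (\<Sum>i=1..h. \<Sum>j\<in>{1..h} - {i}. complex_of_real (offdiag q \<alpha> M x i j)
            * f (eps_minus i (eps_plus j x)))
        + (\<Sum>i=1..h. complex_of_real (Lcoeff q \<alpha> x i * Rcoeff q M (eps_plus i x) i) * f x)"
      using assms(1)
      by (subst sum_split_diag, intro arg_cong2[where f = "(+)"] sum.cong refl)
        (auto simp: Lcoeff_Rcoeff_offdiag)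
    also have "(\<Sum>i=1..h. complex_of_real (Lcoeff q \<alpha> x i * Rcoeff q M (eps_plus i x) i) * f x)
        = complex_of_real ((\<Sum>j=1..h. diag q \<alpha> M x j) + ev q h \<alpha> M - ev q h \<alpha> (Suc M)) * f x"
      unfolding sum_diag[OF assms(1,2) True, symmetric] by (simp add: sum_distrib_right)
    finally show ?thesis
      using D_eq[OF True assms(1)] by (simp add: cscale_def sum_distrib_right[symmetric] distrib_right left_diff_distrib)
  qed
qed

text \<open>Both sides equal \<open>R L R f + ev (M + 1) R f\<close>.\<close>

lemma D_R:
  assumes "q > 0" "h \<ge> 1" "f \<in> V h M"
  shows "D q h \<alpha> (Suc M) (R q h M f) = R q h M (D q h \<alpha> M f)"
proof -
  let ?c = "complex_of_real (ev q h \<alpha> (Suc M))"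
  have "D q h \<alpha> M f = L q h \<alpha> (Suc M) (R q h M f) + cscale ?c f"
    by (simp add: L_R_eq_D[OF assms])
  then show ?thesis
    using D_eq_R_L[OF assms(1) R_V] by (simp add: R_add R_scale)
qed

section \<open>Eigenspaces and spanning\<close>

lemma W_refl: "W q h \<alpha> n n = Ker_L q h \<alpha> n"
  by (simp add: W_def)

lemma W_Suc: "n \<le> N \<Longrightarrow> W q h \<alpha> (Suc N) n = R q h N ` W q h \<alpha> N n"
  by (simp add: W_def image_image)

lemma Ker_L_subspace: "cfun.subspace (Ker_L q h \<alpha> n)"
  using V_subspace[of h n] L_scale[of q h \<alpha> n 0 0]
  by (auto simp: cfun.subspace_def Ker_L_def L_add L_scale)

lemma W_subspace: "n \<le> N \<Longrightarrow> cfun.subspace (W q h \<alpha> N n)"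
proof (induction N rule: dec_induct)
  case base
  then show ?case by (simp add: W_refl Ker_L_subspace)
next
  case (step N)
  have "0 = R q h N 0" using R_scale[of q h N 0 0] by simp
  with step show ?case
    by (auto simp: W_Suc cfun.subspace_def simp flip: R_add R_scale)
qed

lemma W_eigenspace:
  assumes "q > 0" "h \<ge> 1" "n \<le> N"
  shows "W q h \<alpha> N n \<subseteq> eigenspace (V h N) (D q h \<alpha> N) (complex_of_real (ev q h \<alpha> n))"
  using assms(3)
proof (induction N rule: dec_induct)
  case base
  show ?case
  proof (cases n)
    case 0
    then show ?thesis
      by (auto simp: W_refl Ker_L_def eigenspace_def D_0 ev_def cscale_def)
  next
    case (Suc M)
    have "R q h M 0 = 0" using R_scale[of q h M 0 0] by simp
    then show ?thesis
      using Suc assms by (auto simp: W_refl Ker_L_def eigenspace_def D_eq_R_L)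
  qed
next
  case (step N)
  then show ?case
    using assms by (auto simp: W_Suc eigenspace_def R_V D_R R_scale)
qed

lemma W_trivial: "n \<le> N \<Longrightarrow> Ker_L q h \<alpha> n = {0} \<Longrightarrow> W q h \<alpha> N n = {0}"
proof (induction N rule: dec_induct)
  case (step N)
  have "R q h N 0 = 0" using R_scale[of q h N 0 0] by simp
  then have "W q h \<alpha> (Suc N) n = {0}" using step by (simp only: W_Suc image_insert image_empty)
  then show ?case .
qed (simp add: W_refl)

text \<open>
  For \<open>h = 1\<close> and large \<open>\<alpha>\<close> two of the scalars \<open>ev q h \<alpha> n\<close> with \<open>n \<ge> 1\<close> may coincide, but then
  the corresponding kernels vanish.
\<close>

definition separated :: "real \<Rightarrow> nat \<Rightarrow> (nat \<Rightarrow> real) \<Rightarrow> nat \<Rightarrow> bool" where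
  "separated q h \<alpha> N \<longleftrightarrow> (\<forall>m\<le>N. \<forall>n\<le>N. m \<noteq> n \<longrightarrow> ev q h \<alpha> m = ev q h \<alpha> n \<longrightarrow>
     Ker_L q h \<alpha> m = {0} \<and> Ker_L q h \<alpha> n = {0})"

lemma W_span:
  assumes "q > 0" "h \<ge> 1" "separated q h \<alpha> N" "f \<in> V h N"
  shows "\<exists>w. (\<forall>n\<le>N. w n \<in> W q h \<alpha> N n) \<and> f = (\<Sum>n=0..N. w n)"
  using assms(3,4)
proof (induction N arbitrary: f)
  case 0
  then show ?case by (intro exI[of _ "\<lambda>_. f"]) (auto simp: W_refl Ker_L_def L_def)
next
  case (Suc N)
  let ?e = "\<lambda>n. complex_of_real (ev q h \<alpha> n)"
  have "separated q h \<alpha> N"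
    using Suc.prems(1) unfolding separated_def by (meson le_SucI)
  then obtain w where w: "\<And>n. n \<le> N \<Longrightarrow> w n \<in> W q h \<alpha> N n"
    and Lf: "L q h \<alpha> (Suc N) f = (\<Sum>n=0..N. w n)"
    using Suc.IH[OF _ L_V] by blast
  \<comment> \<open>If the two eigenvalues coincide, \<open>1 / 0 = 0\<close> makes
    \<open>v n\<close> zero. This is harmless, since \<open>w n\<close> then lies in a zero
    space.\<close>
  define v where "v n = cscale (1 / (?e n - ?e (Suc N))) (w n)" for n
  have v: "v n \<in> W q h \<alpha> N n" if "n \<le> N" for n
    using w[OF that] W_subspace[OF that] by (simp add: v_def cfun.subspace_scale)
  have LRv: "L q h \<alpha> (Suc N) (R q h N (v n)) = w n" if n: "n \<le> N" for n
  proof (cases "ev q h \<alpha> n = ev q h \<alpha> (Suc N)")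
    case True
    then have "Ker_L q h \<alpha> n = {0}"
      using Suc.prems(1) n by (auto simp: separated_def)
    then have "w n = 0" "v n = 0" using w[OF n] v[OF n] W_trivial[OF n] by auto
    then show ?thesis
      using L_scale[of q h \<alpha> "Suc N" 0 0] R_scale[of q h N 0 0]
      by simp
  next
    case False
    have "v n \<in> V h N" "D q h \<alpha> N (v n) = cscale (?e n) (v n)"
      using W_eigenspace[OF assms(1,2) n] v[OF n] by (auto simp: eigenspace_def)
    then have "L q h \<alpha> (Suc N) (R q h N (v n)) = cscale (?e n - ?e (Suc N)) (v n)"
      using L_R_eq_D[OF assms(1,2)] by (simp add: cfun.scale_left_diff_distrib)
    then show ?thesis using False by (simp add: v_def)
  qed
  define g where "g = (\<Sum>n=0..N. R q h N (v n))"
  have Lg: "L q h \<alpha> (Suc N) g = L q h \<alpha> (Suc N) f"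
    unfolding g_def linear_sum[of "L q h \<alpha> (Suc N)", OF L_add L_scale] Lf
    using LRv by (intro sum.cong) auto
  have "g \<in> V h (Suc N)"
    unfolding g_def by (intro cfun.subspace_sum V_subspace R_V)
  then have "f - g \<in> V h (Suc N)"
    using Suc.prems(2) V_subspace by (blast intro: cfun.subspace_diff)
  moreover have "L q h \<alpha> (Suc N) (f - g) = 0"
    using L_add[of q h \<alpha> "Suc N" "f - g" g] Lg by simp
  ultimately have "f - g \<in> W q h \<alpha> (Suc N) (Suc N)"
    by (simp add: W_refl Ker_L_def)
  moreover have "f = (\<Sum>n=0..Suc N. if n = Suc N then f - g else R q h N (v n))"
    by (simp add: g_def)
  ultimately show ?case
    using v by (intro exI[of _ "\<lambda>n. if n = Suc N then f - g else R q h N (v n)"])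
      (auto simp: W_Suc le_Suc_eq)
qed

lemma eigenvectors_independent:
  fixes T :: "('a \<Rightarrow> complex) \<Rightarrow> ('a \<Rightarrow> complex)"
  assumes add: "\<And>f g. T (f + g) = T f + T g" and scale: "\<And>c f. T (cscale c f) = cscale c (T f)"
    and "finite I" "\<And>n. n \<in> I \<Longrightarrow> T (w n) = cscale (c n) (w n)"
    and "\<And>m n. m \<in> I \<Longrightarrow> n \<in> I \<Longrightarrow> m \<noteq> n \<Longrightarrow> c m = c n \<Longrightarrow> w m = 0"
    and "(\<Sum>n\<in>I. w n) = 0" "n \<in> I"
  shows "w n = 0"
  using assms(3-)
proof (induction I arbitrary: w n rule: finite_induct)
  case (insert a I)
  have T0: "T 0 = 0" using scale[of 0 0] by simp
  have "0 = T (\<Sum>n\<in>insert a I. w n) - cscale (c a) (\<Sum>n\<in>insert a I. w n)"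
    by (simp only: insert.prems(3) T0 cfun.scale_zero_right diff_self)
  also have "\<dots> = (\<Sum>n\<in>insert a I. cscale (c n - c a) (w n))"
    unfolding linear_sum[of T, OF add scale] cfun.scale_sum_right sum_subtractf[symmetric]
    using insert.prems(1) by (intro sum.cong) (auto simp: cfun.scale_left_diff_distrib)
  also have "\<dots> = (\<Sum>n\<in>I. cscale (c n - c a) (w n))"
    using insert.hyps by simp
  finally have sum0: "(\<Sum>n\<in>I. cscale (c n - c a) (w n)) = 0" by simp
  have zero: "w m = 0" if m: "m \<in> I" for m
  proof (cases "c m = c a")
    case True
    then show ?thesis using insert.prems(2)[of m a] insert.hyps m by blast
  next
    case False
    have "cscale (c m - c a) (w m) = 0"
    proof (rule insert.IH[OF _ _ sum0 m])
      fix k assume "k \<in> I"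
      then show "T (cscale (c k - c a) (w k)) = cscale (c k) (cscale (c k - c a) (w k))"
        using insert.prems(1)[of k] by (simp add: scale mult.commute)
    next
      fix k l assume "k \<in> I" "l \<in> I" "k \<noteq> l" "c k = c l"
      then show "cscale (c k - c a) (w k) = 0"
        using insert.prems(2)[of k l] by (metis insertI2 cfun.scale_zero_right)
    qed
    with False show ?thesis by simp
  qed
  have "(\<Sum>n\<in>insert a I. w n) = w a + (\<Sum>n\<in>I. w n)" using insert.hyps by simp
  also have "(\<Sum>n\<in>I. w n) = 0" using zero by (rule sum.neutral[rule_format])
  finally have "w a = 0" by (simp only: insert.prems(3) add_0_right)
  with zero insert.prems(4) show ?case by blast
qed simp

lemma W_independent:
  assumes "q > 0" "h \<ge> 1" "separated q h \<alpha> N"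
    and "\<And>n. n \<in> {0..N} \<Longrightarrow> w n \<in> W q h \<alpha> N n" "(\<Sum>n=0..N. w n) = 0" "n \<in> {0..N}"
  shows "w n = 0"
proof (rule eigenvectors_independent[of "D q h \<alpha> N" "{0..N}" w "\<lambda>n. complex_of_real (ev q h \<alpha> n)"])
  fix m assume "m \<in> {0..N}"
  then show "D q h \<alpha> N (w m) = cscale (complex_of_real (ev q h \<alpha> m)) (w m)"
    using assms(4)[of m] W_eigenspace[OF assms(1,2), of m N \<alpha>] by (auto simp: eigenspace_def)
next
  fix m n assume mn: "m \<in> {0..N}" "n \<in> {0..N}" "m \<noteq> n"
    and "complex_of_real (ev q h \<alpha> m) = complex_of_real (ev q h \<alpha> n)"
  then have "Ker_L q h \<alpha> m = {0}"
    using assms(3) by (auto simp: separated_def)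
  then show "w m = 0" using W_trivial[of m N] assms(4)[of m] mn by auto
qed (use assms D_add D_scale in auto)

lemma W_direct_sum:
  assumes "q > 0" "h \<ge> 1" "separated q h \<alpha> N"
  shows "is_direct_sum (V h N) {0..N} (W q h \<alpha> N)"
  unfolding is_direct_sum_def
proof (intro conjI ballI)
  let ?P = "Pi\<^sub>E {0..N} (W q h \<alpha> N)"
  show "cfun.subspace (W q h \<alpha> N n)" if "n \<in> {0..N}" for n
    using that W_subspace by simp
  have "inj_on (\<lambda>w. \<Sum>n=0..N. w n) ?P"
  proof (rule inj_onI)
    fix v w assume vw: "v \<in> ?P" "w \<in> ?P" and eq: "(\<Sum>n=0..N. v n) = (\<Sum>n=0..N. w n)"
    have "v n - w n = 0" if "n \<in> {0..N}" for n
    proof (rule W_independent[OF assms, of "\<lambda>n. v n - w n"])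
      fix k assume "k \<in> {0..N}"
      then show "v k - w k \<in> W q h \<alpha> N k"
        using vw W_subspace[of k N] by (intro cfun.subspace_diff) auto
    qed (use eq that in \<open>simp_all add: sum_subtractf\<close>)
    then show "v = w" using vw by (intro PiE_ext) auto
  qed
  moreover have "(\<lambda>w. \<Sum>n=0..N. w n) ` ?P = V h N"
  proof (intro subset_antisym subsetI)
    fix f assume "f \<in> (\<lambda>w. \<Sum>n=0..N. w n) ` ?P"
    then obtain w where w: "w \<in> ?P" "f = (\<Sum>n=0..N. w n)" by blast
    have "w n \<in> V h N" if "n \<in> {0..N}" for n
      using w(1) that W_eigenspace[OF assms(1,2), of n N \<alpha>] by (auto simp: eigenspace_def)
    then show "f \<in> V h N"
      unfolding w(2) by (intro cfun.subspace_sum V_subspace)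
  next
    fix f assume "f \<in> V h N"
    then obtain w where "\<forall>n\<le>N. w n \<in> W q h \<alpha> N n" "f = (\<Sum>n=0..N. w n)"
      using W_span[OF assms] by blast
    then show "f \<in> (\<lambda>w. \<Sum>n=0..N. w n) ` ?P"
      by (intro image_eqI[of _ _ "restrict w {0..N}"]) auto
  qed
  ultimately show "bij_betw (\<lambda>w. \<Sum>n=0..N. w n) ?P (V h N)"
    by (simp add: bij_betw_def)
qed

text \<open>For the reverse inclusion, an eigenvector is split into components \<open>w m\<close>.
  Applying \<open>D - ev n\<close> gives a vanishing sum of multiples of the \<open>w m\<close>, so
  by independence only \<open>w n\<close> survives; a component with a colliding eigenvalue is zero
  already.\<close>

lemma W_eq_eigenspace:
  assumes "q > 0" "h \<ge> 1" "separated q h \<alpha> N" "n \<le> N"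
  shows "W q h \<alpha> N n = eigenspace (V h N) (D q h \<alpha> N) (complex_of_real (ev q h \<alpha> n))"
proof (intro subset_antisym W_eigenspace assms subsetI)
  let ?e = "\<lambda>n. complex_of_real (ev q h \<alpha> n)"
  fix f assume "f \<in> eigenspace (V h N) (D q h \<alpha> N) (?e n)"
  then have f: "f \<in> V h N" "D q h \<alpha> N f = cscale (?e n) f" by (auto simp: eigenspace_def)
  obtain w where w: "\<And>m. m \<le> N \<Longrightarrow> w m \<in> W q h \<alpha> N m" "f = (\<Sum>m=0..N. w m)"
    using W_span[OF assms(1-3) f(1)] by blast
  have Dw: "D q h \<alpha> N (w m) = cscale (?e m) (w m)" if "m \<le> N" for m
    using W_eigenspace[OF assms(1,2) that] w(1)[OF that] by (auto simp: eigenspace_def)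
  have "(\<Sum>m=0..N. cscale (?e m - ?e n) (w m)) = D q h \<alpha> N f - cscale (?e n) f"
    unfolding w(2) linear_sum[of "D q h \<alpha> N", OF D_add D_scale] cfun.scale_sum_right
      sum_subtractf[symmetric]
    using Dw by (intro sum.cong) (auto simp: cfun.scale_left_diff_distrib)
  then have sum0: "(\<Sum>m=0..N. cscale (?e m - ?e n) (w m)) = 0" using f(2) by simp
  have "w m = 0" if m: "m \<in> {0..N}" "m \<noteq> n" for m
  proof (cases "ev q h \<alpha> m = ev q h \<alpha> n")
    case True
    then have "Ker_L q h \<alpha> m = {0}" using assms(3,4) m by (auto simp: separated_def)
    then show ?thesis using W_trivial[of m N] w(1)[of m] m by auto
  next
    case False
    have "cscale (?e m - ?e n) (w m) = 0"
      using w(1) W_subspace[of _ N]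
      by (intro W_independent[OF assms(1-3) _ sum0 m(1)] cfun.subspace_scale) auto
    with False show ?thesis by simp
  qed
  then have "f = w n"
    unfolding w(2) using assms(4) by (subst sum.remove[of _ n]) auto
  then show "f \<in> W q h \<alpha> N n" using w(1)[OF assms(4)] by simp
qed

section \<open>Orthogonality\<close>

definition weight :: "real \<Rightarrow> nat \<Rightarrow> (nat \<Rightarrow> real) \<Rightarrow> nat \<Rightarrow> point \<Rightarrow> real" where
  "weight q h \<alpha> M x = q ^ (M * (M + 1) div 2) *
     (\<Prod>i=1..h. qpoch (q * \<alpha> i) q (x i) / qpoch q q (x i) * (\<alpha> i * q) ^ (M - X x i))"

lemma scalar_product_weight:
  "scalar_product q h \<alpha> M f g
     = (\<Sum>x\<in>compositions h M. complex_of_real (weight q h \<alpha> M x) * f x * cnj (g x))"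
  by (simp add: scalar_product_def weight_def sum_distrib_left mult.assoc)

text \<open>The adjointness of \<open>R\<close> and \<open>-L\<close> at the level of coefficients.
  Raising \<open>y_i\<close> adds one factor to each of the two q-shifted factorials; it increases
  the exponent \<open>M - X_k\<close> by 1 for \<open>k < i\<close>, which produces
  \<open>A_(i-1) q^(i-1)\<close>, and leaves it unchanged for \<open>k \<ge> i\<close>. The
  prefactor grows by \<open>q^(M+1)\<close>, cancelling the negative power in
  \<open>Rcoeff\<close>.\<close>

lemma weight_eps_plus:
  assumes "0 < q" "q < 1" "y \<in> compositions h M" "i \<in> {1..h}"
  shows "weight q h \<alpha> (Suc M) (eps_plus i y) * Rcoeff q M (eps_plus i y) i
    = - (weight q h \<alpha> M y * Lcoeff q \<alpha> y i)"
proof -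
  let ?x = "eps_plus i y"
  have q1: "1 - q ^ Suc k \<noteq> 0" for k
    using assms power_Suc_less_one[of q k] by simp
  have XM: "X y k \<le> M" if "k \<le> h" for k
    using X_mono[OF that, of y] assms(3) by (auto simp: compositions_X)
  have "qpoch (q * \<alpha> k) q (?x k) / qpoch q q (?x k) * (\<alpha> k * q) ^ (Suc M - X ?x k)
     = (qpoch (q * \<alpha> k) q (y k) / qpoch q q (y k) * (\<alpha> k * q) ^ (M - X y k))
       * (if k < i then \<alpha> k * q else 1)
       * (if k = i then (1 - \<alpha> i * q ^ Suc (y i)) / (1 - q ^ Suc (y i)) else 1)" if "k \<in> {1..h}" for k
    using that assms XM[of k] q1
    by (auto simp: X_eps_plus Suc_diff_le) (auto simp: eps_plus_def qpoch_def mult.commute mult.left_commute)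
  then have "(\<Prod>k=1..h. qpoch (q * \<alpha> k) q (?x k) / qpoch q q (?x k) * (\<alpha> k * q) ^ (Suc M - X ?x k))
     = (\<Prod>k=1..h. qpoch (q * \<alpha> k) q (y k) / qpoch q q (y k) * (\<alpha> k * q) ^ (M - X y k))
       * (\<Prod>k=1..h. if k < i then \<alpha> k * q else 1)
       * (\<Prod>k=1..h. if k = i then (1 - \<alpha> i * q ^ Suc (y i)) / (1 - q ^ Suc (y i)) else 1)"
    unfolding prod.distrib[symmetric] by (intro prod.cong) auto
  also have "(\<Prod>k=1..h. if k = i then (1 - \<alpha> i * q ^ Suc (y i)) / (1 - q ^ Suc (y i)) else 1)
     = (1 - \<alpha> i * q ^ Suc (y i)) / (1 - q ^ Suc (y i))"
    using assms(4) by simp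
  also have "(\<Prod>k=1..h. if k < i then \<alpha> k * q else 1) = (\<Prod>k=1..i-1. \<alpha> k * q)"
    using assms(4) by (intro prod.mono_neutral_cong_right) auto
  also have "\<dots> = A \<alpha> (i - 1) * q ^ (i - 1)"
    by (simp add: A_def prod.distrib)
  finally have P: "(\<Prod>k=1..h. qpoch (q * \<alpha> k) q (?x k) / qpoch q q (?x k) * (\<alpha> k * q) ^ (Suc M - X ?x k))
     = (\<Prod>k=1..h. qpoch (q * \<alpha> k) q (y k) / qpoch q q (y k) * (\<alpha> k * q) ^ (M - X y k))
       * (A \<alpha> (i - 1) * q ^ (i - 1)) * ((1 - \<alpha> i * q ^ Suc (y i)) / (1 - q ^ Suc (y i)))" .
  have "Suc M * (Suc M + 1) div 2 = M * (M + 1) div 2 + Suc M"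
    by simp
  then have E: "q ^ (Suc M * (Suc M + 1) div 2) = q ^ (M * (M + 1) div 2) * q ^ Suc M"
    by (simp only: power_add)
  have Rc: "Rcoeff q M ?x i = q ^ X y (i - 1) / q ^ Suc M * (1 - q ^ Suc (y i))"
  proof -
    have "X ?x (i - 1) = X y (i - 1)" "?x i = Suc (y i)"
      using assms(4) by (auto simp: X_eps_plus) (auto simp: eps_plus_def)
    then show ?thesis using assms(1) by (simp add: Rcoeff_def power_int_diff)
  qed
  show ?thesis
    unfolding weight_def P E Rc Lcoeff_def
    using assms(1) q1[of "y i"] by (simp add: field_simps power_add)
qed

lemma sum_compositions_shift:
  fixes F :: "point \<Rightarrow> 'a::comm_monoid_add"
  assumes "i \<in> {1..h}" "\<And>x. x i = 0 \<Longrightarrow> F x = 0"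
  shows "(\<Sum>x\<in>compositions h (Suc M). F x) = (\<Sum>y\<in>compositions h M. F (eps_plus i y))"
proof -
  have "(\<Sum>x\<in>compositions h (Suc M). F x) = (\<Sum>x\<in>{x \<in> compositions h (Suc M). x i > 0}. F x)"
    using finite_compositions assms(2) by (intro sum.mono_neutral_right) auto
  also have "\<dots> = (\<Sum>y\<in>compositions h M. F (eps_plus i y))"
    using assms(1)
    by (intro sum.reindex_bij_witness[of _ "eps_plus i" "eps_minus i"])
      (auto simp: eps_plus_minus eps_minus_compositions eps_plus_compositions, auto simp: eps_plus_def)
  finally show ?thesis .
qed

lemma R_adjoint:
  assumes "0 < q" "q < 1"
  shows "scalar_product q h \<alpha> (Suc M) (R q h M f) g = - scalar_product q h \<alpha> M f (L q h \<alpha> (Suc M) g)"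
proof -
  let ?w = "weight q h \<alpha>"
  let ?F = "\<lambda>i x. complex_of_real (?w (Suc M) x * Rcoeff q M x i) * f (eps_minus i x) * cnj (g x)"
  have "scalar_product q h \<alpha> (Suc M) (R q h M f) g = (\<Sum>x\<in>compositions h (Suc M). \<Sum>i=1..h. ?F i x)"
    unfolding scalar_product_weight
    by (intro sum.cong) (auto simp: R_eq sum_distrib_left sum_distrib_right mult.assoc)
  also have "\<dots> = (\<Sum>i=1..h. \<Sum>x\<in>compositions h (Suc M). ?F i x)"
    by (rule sum.swap)
  also have "\<dots> = (\<Sum>i=1..h. \<Sum>y\<in>compositions h M. ?F i (eps_plus i y))"
    by (intro sum.cong refl sum_compositions_shift) (auto simp: Rcoeff_def)
  also have "\<dots> = (\<Sum>i=1..h. \<Sum>y\<in>compositions h M.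
      - (complex_of_real (?w M y * Lcoeff q \<alpha> y i) * f y * cnj (g (eps_plus i y))))"
    by (intro sum.cong refl, subst weight_eps_plus[OF assms]) auto
  also have "\<dots> = (\<Sum>y\<in>compositions h M. \<Sum>i=1..h.
      - (complex_of_real (?w M y * Lcoeff q \<alpha> y i) * f y * cnj (g (eps_plus i y))))"
    by (rule sum.swap)
  also have "\<dots> = - scalar_product q h \<alpha> M f (L q h \<alpha> (Suc M) g)"
    unfolding scalar_product_weight sum_negf[symmetric]
    by (intro sum.cong) (auto simp: L_eq sum_distrib_left sum_negf ac_simps)
  finally show ?thesis .
qed

lemma scalar_product_cnj: "scalar_product q h \<alpha> M g f = cnj (scalar_product q h \<alpha> M f g)"
  by (simp add: scalar_product_weight ac_simps)

lemma scalar_product_add: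
  "scalar_product q h \<alpha> M (f1 + f2) g = scalar_product q h \<alpha> M f1 g + scalar_product q h \<alpha> M f2 g"
  by (simp add: scalar_product_weight algebra_simps sum.distrib)

lemma scalar_product_scale:
  "scalar_product q h \<alpha> M (cscale c f) g = c * scalar_product q h \<alpha> M f g"
  by (simp add: scalar_product_weight cscale_def sum_distrib_left ac_simps)

text \<open>For \<open>M > 0\<close> the factorization gives
  \<open>-<L f, L g> + ev M <f, g>\<close>, which is Hermitian in \<open>f\<close> and
  \<open>g\<close> because the weight and \<open>ev M\<close> are real.\<close>

lemma D_selfadjoint:
  assumes "0 < q" "q < 1" "f \<in> V h M" "g \<in> V h M"
  shows "scalar_product q h \<alpha> M (D q h \<alpha> M f) g = scalar_product q h \<alpha> M f (D q h \<alpha> M g)"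
proof (cases M)
  case 0
  then show ?thesis by (simp add: D_0 scalar_product_weight)
next
  case (Suc K)
  have *: "scalar_product q h \<alpha> M (D q h \<alpha> M u) v
      = - scalar_product q h \<alpha> K (L q h \<alpha> M u) (L q h \<alpha> M v)
        + complex_of_real (ev q h \<alpha> M) * scalar_product q h \<alpha> M u v" if "u \<in> V h M" for u v
    using that assms Suc by (simp add: D_eq_R_L scalar_product_add scalar_product_scale R_adjoint)
  show ?thesis
    using scalar_product_cnj[of q h \<alpha> M f "D q h \<alpha> M g"] *[OF assms(3), of g] *[OF assms(4), of f]
      scalar_product_cnj[of q h \<alpha> M f g]
      scalar_product_cnj[of q h \<alpha> K "L q h \<alpha> M f" "L q h \<alpha> M g"]
    by simp
qed

lemma W_orthogonal:
  assumes "0 < q" "q < 1" "h \<ge> 1" "separated q h \<alpha> N" "m \<le> N" "n \<le> N" "m \<noteq> n"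
    and "f \<in> W q h \<alpha> N m" "g \<in> W q h \<alpha> N n"
  shows "scalar_product q h \<alpha> N f g = 0"
proof (cases "ev q h \<alpha> m = ev q h \<alpha> n")
  case True
  then have "Ker_L q h \<alpha> m = {0}" using assms by (auto simp: separated_def)
  then show ?thesis using W_trivial[of m N] assms by (simp add: scalar_product_weight)
next
  case False
  have f: "f \<in> V h N" "D q h \<alpha> N f = cscale (complex_of_real (ev q h \<alpha> m)) f"
    using W_eigenspace[OF assms(1,3,5)] assms(8) by (auto simp: eigenspace_def)
  have g: "g \<in> V h N" "D q h \<alpha> N g = cscale (complex_of_real (ev q h \<alpha> n)) g"
    using W_eigenspace[OF assms(1,3,6)] assms(9) by (auto simp: eigenspace_def)
  have "complex_of_real (ev q h \<alpha> m) * scalar_product q h \<alpha> N f g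
      = scalar_product q h \<alpha> N f (cscale (complex_of_real (ev q h \<alpha> n)) g)"
    using D_selfadjoint[OF assms(1,2) f(1) g(1), of \<alpha>] by (simp add: f g scalar_product_scale)
  also have "\<dots> = complex_of_real (ev q h \<alpha> n) * scalar_product q h \<alpha> N f g"
    by (simp add: scalar_product_weight cscale_def sum_distrib_left ac_simps)
  finally show ?thesis using False by simp
qed

section \<open>Separation of the eigenvalues\<close>

text \<open>Up to a constant, \<open>ev n\<close> is \<open>1/t + c t\<close> at
  \<open>t = q^n\<close> with \<open>c = A_h q^(h-1)\<close>. Equal values at
  \<open>s \<noteq> t\<close> force \<open>c s t = 1\<close>.\<close>

lemma ev_eq_imp:
  assumes "0 < q" "q < 1" "h \<ge> 1" "m \<noteq> n" "ev q h \<alpha> m = ev q h \<alpha> n"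
  shows "A \<alpha> h * q ^ (h - 1 + m + n) = 1"
proof -
  obtain k where k: "h = Suc k" using assms by (cases h) auto
  have "(q ^ m - q ^ n) * (A \<alpha> h * q ^ (k + m + n) - 1) =
     q ^ m * q ^ n * (ev q h \<alpha> m - ev q h \<alpha> n)"
    using assms(1) unfolding ev_alt[OF assms(1,3), unfolded k] k
    by (simp add: field_simps power_add)
  moreover have "q ^ m \<noteq> q ^ n" using assms by (simp add: power_inject_exp')
  ultimately show ?thesis using assms k by simp
qed

text \<open>\<open>[1;n]\<close> is a single point, and \<open>L\<close> multiplies the value there
  by \<open>\<alpha>_1 q^n - 1\<close>.\<close>

lemma Ker_L_one:
  assumes "\<alpha> 1 * q ^ n \<noteq> 1" "n \<ge> 1"
  shows "Ker_L q 1 \<alpha> n = {0}"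
proof -
  obtain M where M: "n = Suc M" using assms by (cases n) auto
  have "f x = 0" if f: "f \<in> V 1 n" "L q 1 \<alpha> n f = 0" for f x
  proof (cases "x \<in> compositions 1 n")
    case True
    define y where "y = eps_minus 1 x"
    have x: "x = eps_plus 1 y" "x 1 = n" "y 1 = M" "y \<in> compositions 1 M"
      using True M eps_minus_compositions[of x 1 M 1]
      by (auto simp: y_def compositions_def eps_minus_def eps_plus_def)
    have "0 = L q 1 \<alpha> n f y" using f by simp
    also have "\<dots> = complex_of_real (\<alpha> 1 * q ^ n - 1) * f x"
      using x M by (simp add: L_eq Lcoeff_def)
    finally show ?thesis using assms by (simp flip: of_real_mult)
  qed (use f in \<open>auto simp: V_def\<close>)
  then show ?thesis
    using cfun.subspace_0[OF Ker_L_subspace[of q 1 \<alpha> n]] by (auto simp: Ker_L_def)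
qed

lemma prod_less_1:
  fixes f :: "nat \<Rightarrow> real"
  assumes "h \<ge> 1" "\<And>i. i \<in> {1..h} \<Longrightarrow> 0 < f i \<and> f i < 1"
  shows "0 < prod f {1..h} \<and> prod f {1..h} < 1"
  using assms
proof (induction h rule: nat_induct_at_least)
  case (Suc h)
  then show ?case
    using mult_strict_mono[of "f (Suc h)" 1 "prod f {1..h}" 1]
    by (auto simp: prod.nat_ivl_Suc' mult.commute)
qed simp

lemma A_power: "A \<alpha> h * q ^ (k * h) = (\<Prod>i=1..h. \<alpha> i * q ^ k)"
  by (simp add: A_def prod.distrib power_mult)

text \<open>No collision occurs: \<open>m \<noteq> n\<close> gives
  \<open>h - 1 + m + n \<ge> h\<close>, while \<open>A_h q^h < 1\<close>.\<close>

lemma separated_small: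
  assumes "0 < q" "q < 1" "h \<ge> 1" "\<forall>i\<in>{1..h}. 0 < \<alpha> i \<and> \<alpha> i < inverse q"
  shows "separated q h \<alpha> N"
proof -
  have A: "0 < A \<alpha> h * q ^ h" "A \<alpha> h * q ^ h < 1"
    using prod_less_1[of h "\<lambda>i. \<alpha> i * q ^ 1"] assms A_power[of \<alpha> h q 1]
    by (auto simp: field_simps)
  have "ev q h \<alpha> m \<noteq> ev q h \<alpha> n" if "m \<noteq> n" for m n
  proof
    assume "ev q h \<alpha> m = ev q h \<alpha> n"
    then have "A \<alpha> h * q ^ (h - 1 + m + n) = 1" using ev_eq_imp assms that by blast
    moreover have "h - 1 + m + n = h + (m + n - 1)" using assms(3) that by simp
    ultimately have "(A \<alpha> h * q ^ h) * q ^ (m + n - 1) = 1" by (simp only: power_add mult.assoc)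
    moreover have "(A \<alpha> h * q ^ h) * q ^ (m + n - 1) \<le> A \<alpha> h * q ^ h"
      using A assms by (intro mult_left_le power_le_one) auto
    ultimately show False using A by simp
  qed
  then show ?thesis by (auto simp: separated_def)
qed

text \<open>Here \<open>A_h q^(N h) > 1\<close>, so a collision forces
  \<open>N h < h - 1 + m + n\<close>. This leaves \<open>h = 1\<close> and
  \<open>m, n \<ge> 1\<close>, where \<open>\<alpha>_1 q^k > 1\<close> for all
  \<open>k \<le> N\<close> makes both kernels trivial.\<close>

lemma separated_large:
  assumes "0 < q" "q < 1" "h \<ge> 1" "\<forall>i\<in>{1..h}. \<alpha> i > q powi (- int N)"
  shows "separated q h \<alpha> N"
proof -
  have a: "\<alpha> i * q ^ N > 1" if "i \<in> {1..h}" for i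
    using assms(1,4) that by (auto simp: power_int_minus field_simps)
  have "prod (\<lambda>i. 1) {1..h} < (\<Prod>i=1..h. \<alpha> i * q ^ N)"
    using a assms(3) by (intro prod_mono_strict) (force intro: less_imp_le less_trans[OF zero_less_one])+
  then have A: "1 < A \<alpha> h * q ^ (N * h)" by (simp add: A_power)
  have "Ker_L q h \<alpha> m = {0} \<and> Ker_L q h \<alpha> n = {0}"
    if mn: "m \<le> N" "n \<le> N" "m \<noteq> n" "ev q h \<alpha> m = ev q h \<alpha> n" for m n
  proof -
    have eq: "A \<alpha> h * q ^ (h - 1 + m + n) = 1"
      using ev_eq_imp[OF assms(1-3) mn(3,4)] .
    have less: "N * h < h - 1 + m + n"
    proof (rule ccontr)
      assume "\<not> N * h < h - 1 + m + n"
      then have "q ^ (N * h) \<le> q ^ (h - 1 + m + n)"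
        using assms by (intro power_decreasing) auto
      moreover have "A \<alpha> h > 0" using A assms(1) by (smt (verit) zero_less_mult_pos2 zero_less_power)
      ultimately show False using A eq mult_left_mono[of "q ^ (N * h)" "q ^ (h - 1 + m + n)" "A \<alpha> h"] by auto
    qed
    obtain K where K: "N = Suc K" using mn by (cases N) auto
    \<comment> \<open>Distinct \<open>m, n \<le> N\<close> have \<open>m + n \<le> 2N - 1\<close>,
      so \<open>less\<close> gives \<open>N (h - 2) < h - 2\<close>, impossible for
      \<open>h \<ge> 2\<close> and \<open>N \<ge> 1\<close>.\<close>
    have h1: "h = 1"
    proof (rule ccontr)
      assume "h \<noteq> 1"
      then obtain k where "h = k + 2"
        using assms(3) by (metis add.commute le_Suc_ex nat_less_le numeral_2_eq_2 Suc_le_eq One_nat_def)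
      then show False using less mn K by (simp add: algebra_simps)
    qed
    have "m \<ge> 1" "n \<ge> 1" using less mn h1 by auto
    moreover have "\<alpha> 1 * q ^ k \<noteq> 1" if "k \<le> N" for k
    proof -
      have "q ^ N \<le> q ^ k" using assms that by (intro power_decreasing) auto
      moreover have "\<alpha> 1 > 0"
      proof -
        have "0 < \<alpha> 1 * q ^ N" using a[of 1] h1 by simp
        then show ?thesis using assms(1) by (simp add: zero_less_mult_iff)
      qed
      ultimately have "\<alpha> 1 * q ^ N \<le> \<alpha> 1 * q ^ k" by simp
      then show ?thesis using a[of 1] h1 by simp
    qed
    ultimately show ?thesis using mn Ker_L_one h1 by auto
  qed
  then show ?thesis by (auto simp: separated_def)
qed

theorem theorem2p7:
  fixes q :: real and h N :: nat and \<alpha> :: "nat \<Rightarrow> real"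
  assumes "0 < q" and "q < 1" and "h \<ge> 1"
    and "(\<forall>i\<in>{1..h}. 0 < \<alpha> i \<and> \<alpha> i < inverse q) \<or> (\<forall>i\<in>{1..h}. \<alpha> i > q powi (- int N))"
  shows "is_direct_sum (V h N) {0..N} (W q h \<alpha> N)
    \<and> (\<forall>m\<in>{0..N}. \<forall>n\<in>{0..N}. m \<noteq> n \<longrightarrow>
         (\<forall>f\<in>W q h \<alpha> N m. \<forall>g\<in>W q h \<alpha> N n. scalar_product q h \<alpha> N f g = 0))
    \<and> (\<forall>n\<in>{0..N}. W q h \<alpha> N n =
         eigenspace (V h N) (D q h \<alpha> N)
           (complex_of_real (q powi (- int n) * (1 - q ^ n) * (1 - A \<alpha> h * q powi (int n + int h - 1)))))"
proof -
  have "separated q h \<alpha> N"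
    using assms separated_small separated_large by blast
  then show ?thesis
    using assms W_direct_sum W_orthogonal W_eq_eigenspace by (auto simp flip: ev_def)
qed

end
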